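(* Consider iterated Bayesian linear regression in $\mathbb R^d$ with prior $N(\bar\mu,\bar\sigma^2I_d)$, noise variance $\sigma^2$, and initial distribution $N(\mu_0,\bar\sigma^2I_d)$ of learner $0$. For every constant $c>0$ there is a constant $D_c$ depending only on $c$ such that, for all sufficiently small $\delta,\varepsilon>0$, the sample size sequence $$m_t=D_c\frac{\|\mu_0-\bar\mu\|_2}{\delta}\Bigl(\frac{\sigma}{\bar\sigma}\Bigr)^2t^{1+c}+D_c\,d\log\frac{t+1}{\varepsilon}$$ ensures that $\|\mathbb E\mu_t-\mu_0\|_2\le\delta$ with probability greater than $1-\varepsilon$ (over the random design matrices $X_1,X_2,\dots$).
   Context: Iterated Bayesian linear regression: hypotheses $h\in\mathbb R^d$, common prior $N(\bar\mu,\bar\sigma^2I_d)$. Learner $0$'s distribution is $N(\mu_0,\Sigma_0)$ with $\Sigma_0=\bar\sigma^2I_d$. Learner $t\ge1$ samples $h\sim N(\mu_{t-1},\Sigma_{t-1})$ (the posterior of learner $t-1$), draws an $m_t\times d$ matrix $X_t$ with i.i.d. $N(0,1)$ entries and noise $\phi_t\sim N(0,\sigma^2I_{m_t})$ independently, observes $y_t=X_th+\phi_t$, and forms the posterior $N(\mu_t,\Sigma_t)$ with $\Sigma_t=(\bar\sigma^{-2}I_d+\sigma^{-2}X_t^TX_t)^{-1}$ and $\mu_t=\Sigma_t(\bar\sigma^{-2}\bar\mu+\sigma^{-2}X_t^Ty_t)$. Here $\mathbb E\mu_t$ denotes the expectation of $\mu_t$ over the sampled hypotheses and noises, conditional on $X_1,\dots,X_t$;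 thus $\mathbb E\mu_t$ is a random vector depending on $X_1,\dots,X_t$, satisfying $\mathbb E\mu_t=(I_d+M_t)^{-1}(\bar\mu+M_t\mathbb E\mu_{t-1})$ with $M_t=(\bar\sigma/\sigma)^2X_t^TX_t$. The logarithm is natural. *)

theory Defs
  imports "HOL-Probability.Probability" "Jordan_Normal_Form.Gauss_Jordan_Elimination"
begin

text \<open>Vectors in R^d and d x d matrices are Jordan_Normal_Form vectors/matrices whose
  dimension d is an ordinary natural number (so that constants can be uniform in d).\<close>

definition std_gauss :: "real measure" where
  "std_gauss = density lborel std_normal_density"

text \<open>Random designs: omega (t,i,j) is entry (i,j) of the design matrix X_t (row i, column j).
  All entries of all design matrices are i.i.d. N(0,1) (infinite product measure);
  X_t uses the entries with i < m_t and j < d.\<close>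
definition design_space :: "(nat \<times> nat \<times> nat \<Rightarrow> real) measure" where
  "design_space = (\<Pi>\<^sub>M k\<in>UNIV. std_gauss)"

definition design :: "nat \<Rightarrow> nat \<Rightarrow> (nat \<times> nat \<times> nat \<Rightarrow> real) \<Rightarrow> nat \<Rightarrow> real mat" where
  "design d m \<omega> t = mat m d (\<lambda>(i, j). \<omega> (t, i, j))"

definition Mmat :: "nat \<Rightarrow> real \<Rightarrow> real \<Rightarrow> (nat \<Rightarrow> nat) \<Rightarrow> (nat \<times> nat \<times> nat \<Rightarrow> real) \<Rightarrow> nat \<Rightarrow> real mat" where
  "Mmat d sg sbar m \<omega> t =
     ((sbar / sg)^2) \<cdot>\<^sub>m (transpose_mat (design d (m t) \<omega> t) * design d (m t) \<omega> t)"

text \<open>E mu_t (expectation over hypotheses and noise, conditional on the designs):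
  E mu_0 = mu_0,  E mu_t = (I + M_t)^{-1} (mubar + M_t E mu_{t-1}).
  (I + M_t is positive definite, hence invertible, so mat_inverse returns Some.)\<close>
primrec Emu :: "nat \<Rightarrow> real \<Rightarrow> real \<Rightarrow> real vec \<Rightarrow> real vec \<Rightarrow> (nat \<Rightarrow> nat)
    \<Rightarrow> (nat \<times> nat \<times> nat \<Rightarrow> real) \<Rightarrow> nat \<Rightarrow> real vec" where
  "Emu d sg sbar mubar mu0 m \<omega> 0 = mu0"
| "Emu d sg sbar mubar mu0 m \<omega> (Suc t) =
     the (mat_inverse (1\<^sub>m d + Mmat d sg sbar m \<omega> (Suc t)))
       *\<^sub>v (mubar + Mmat d sg sbar m \<omega> (Suc t) *\<^sub>v Emu d sg sbar mubar mu0 m \<omega> t)"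

definition norm2 :: "real vec \<Rightarrow> real" where
  "norm2 v = sqrt (\<Sum>i<dim_vec v. (v $ i)^2)"

text \<open>Sample size m_t = D (r / delta) (sg/sbar)^2 t^(1+c) + D d log((t+1)/eps),
  with r = ||mu0 - mubar||, rounded up to an integer.\<close>
definition sample_size :: "real \<Rightarrow> real \<Rightarrow> nat \<Rightarrow> real \<Rightarrow> real \<Rightarrow> real \<Rightarrow> real \<Rightarrow> real \<Rightarrow> nat \<Rightarrow> nat" where
  "sample_size c D d r sg sbar delta eps t =
     nat \<lceil>D * (r / delta) * (sg / sbar)^2 * real t powr (1 + c)
          + D * real d * ln ((real t + 1) / eps)\<rceil>"

end

theory Submission
  imports Defs "Jordan_Normal_Form.Determinant"
begin

text \<open>
  Write \<open>x\<^sub>t\<close> for the mean after \<open>t\<close> rounds, \<open>r\<close> for the distance of \<open>\<mu>\<^sub>0\<close> and the prior mean, and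
  \<open>w = x\<^sub>t - x\<^sub>t\<^sub>+\<^sub>1\<close>. Then \<open>(I + M) w = x\<^sub>t - \<mu>\<close> with \<open>\<mu>\<close> the prior mean and \<open>M = M\<^sub>t\<^sub>+\<^sub>1\<close>. Pairing
  this with \<open>w\<close> shows that the distance to \<open>\<mu>\<close> never increases and that \<open>\<lambda> |w| \<le> r\<close> whenever \<open>M\<close> is
  bounded below by \<open>\<lambda>\<close>. If the Gram matrix of the \<open>t\<close>-th design is bounded below by \<open>m\<^sub>t / 16\<close>, the
  increments are therefore summable because of the factor \<open>t\<close> to the power \<open>1 + c\<close> in \<open>m\<^sub>t\<close>, and
  the total drift is at most \<open>\<delta>\<close>.

  The lower bound on the Gram matrix fails with probability at most \<open>F exp (- m\<^sub>t / 4)\<close>: for a fixed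
  unit vector this is a Chernoff bound for a sum of squares of independent standard normals, and a
  finite net of the sphere together with an upper bound for the columns gives all vectors at once.
  The size of the net, hence \<open>F\<close>, depends on the dimension, but \<open>\<epsilon>\<close> may be taken small depending
  on \<open>d\<close>, so only the finiteness of the net matters; the logarithmic term of \<open>m\<^sub>t\<close> turns the
  bound into \<open>F (\<epsilon> / (t + 1))\<^sup>3\<close>, whose sum over \<open>t\<close> is below \<open>\<epsilon>\<close>.
\<close>

subsection \<open>Tails of the Gaussian quadratic form\<close>

text \<open>The Gaussian tilt \<open>exp (- a * x^2)\<close> turns the standard normal density into
  \<open>s\<close> times the centred normal density with variance
  \<open>s^2 = 1 / (1 + 2 * a)\<close>, whose total mass is 1. The hypothesis makes this variance
  positive.\<close>

lemma nn_integral_std_normal_exp_square: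
  fixes a :: real
  assumes "1 + 2 * a > 0"
  shows "(\<integral>\<^sup>+x. ennreal (std_normal_density x) * ennreal (exp (- a * x\<^sup>2)) \<partial>lborel)
    = ennreal (1 / sqrt (1 + 2 * a))"
proof -
  define s where "s = 1 / sqrt (1 + 2 * a)"
  have s: "s > 0" and s2: "s\<^sup>2 = 1 / (1 + 2 * a)"
    using assms by (simp_all add: s_def power_divide)
  have eq: "std_normal_density x * exp (- a * x\<^sup>2) = s * normal_density 0 s x" for x
  proof -
    have "- (x\<^sup>2) / 2 + - a * x\<^sup>2 = - (x\<^sup>2) / (2 * s\<^sup>2)"
      using assms by (simp add: s2 field_simps)
    then have "exp (- (x\<^sup>2) / 2) * exp (- a * x\<^sup>2) = exp (- (x\<^sup>2) / (2 * s\<^sup>2))"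
      by (simp flip: exp_add)
    then show ?thesis
      using s by (simp add: normal_density_def std_normal_density_def real_sqrt_mult)
  qed
  have "(\<integral>\<^sup>+x. ennreal (std_normal_density x) * ennreal (exp (- a * x\<^sup>2)) \<partial>lborel)
      = (\<integral>\<^sup>+x. ennreal s * ennreal (normal_density 0 s x) \<partial>lborel)"
    using s by (intro nn_integral_cong) (simp add: eq[simplified] flip: ennreal_mult)
  also have "\<dots> = ennreal s"
    using s by (simp add: nn_integral_cmult nn_integral_eq_integral normal_density_nonneg)
  finally show ?thesis
    by (simp add: s_def)
qed

section \<open>The probability space of the design entries\<close>

lemma prob_space_std_gauss: "prob_space std_gauss"
  unfolding std_gauss_def by (rule prob_space_normal_density) simp

lemma sets_std_gauss [measurable_cong]: "sets std_gauss = sets borel"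
  by (simp add: std_gauss_def)

lemma space_std_gauss [simp]: "space std_gauss = UNIV"
  by (simp add: std_gauss_def)

lemma space_design_space [simp]: "space design_space = UNIV"
  by (simp add: design_space_def space_PiM)

interpretation ds: prob_space design_space
  unfolding design_space_def by (intro prob_space_PiM prob_space_std_gauss)

lemma measurable_design_coordinate:
  "(\<lambda>\<omega>. \<omega> k) \<in> borel_measurable design_space"
  unfolding design_space_def by measurable

lemma distr_design_coordinate: "distr design_space borel (\<lambda>\<omega>. \<omega> k) = std_gauss"
proof -
  have "distr design_space borel (\<lambda>\<omega>. \<omega> k) = distr design_space std_gauss (\<lambda>\<omega>. \<omega> k)"
    by (intro distr_cong) (simp_all add: sets_std_gauss)
  also have "\<dots> = std_gauss"
    unfolding design_space_def by (rule distr_PiM_component) (simp_all add: prob_space_std_gauss)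
  finally show ?thesis .
qed

text \<open>Independence is checked through the joint law: the family of all coordinates is the
  identity map, so its law is \<open>design_space\<close> itself, which is by definition the product
  of the marginals.\<close>

lemma indep_design_coordinates: "ds.indep_vars (\<lambda>_. borel) (\<lambda>k \<omega>. \<omega> k) UNIV"
proof -
  have "sets design_space = sets (\<Pi>\<^sub>M k\<in>UNIV. borel)"
    unfolding design_space_def by (intro sets_PiM_cong) (simp_all add: sets_std_gauss)
  then have "distr design_space (\<Pi>\<^sub>M k\<in>UNIV. borel) (\<lambda>\<omega>. \<lambda>k\<in>UNIV. \<omega> k) = design_space"
    by (intro trans[OF distr_cong distr_id]) auto
  also have "\<dots> = (\<Pi>\<^sub>M k\<in>UNIV. distr design_space borel (\<lambda>\<omega>. \<omega> k))"
    by (simp only: distr_design_coordinate) (rule design_space_def)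
  finally show ?thesis
    by (subst ds.indep_vars_iff_distr_eq_PiM) (auto simp: measurable_design_coordinate)
qed

section \<open>Row products and their exponential moments\<close>

definition row_dot :: "nat \<Rightarrow> (nat \<times> nat \<times> nat \<Rightarrow> real) \<Rightarrow> nat \<Rightarrow> nat \<Rightarrow> (nat \<Rightarrow> real) \<Rightarrow> real" where
  "row_dot d \<omega> t i u = (\<Sum>j<d. \<omega> (t, i, j) * u j)"

text \<open>The squared norm of \<open>X\<^sub>t u\<close>, without matrices, so that the coordinates stay visible.\<close>

definition design_form :: "nat \<Rightarrow> nat \<Rightarrow> (nat \<times> nat \<times> nat \<Rightarrow> real) \<Rightarrow> nat \<Rightarrow> (nat \<Rightarrow> real) \<Rightarrow> real" where
  "design_form d m \<omega> t u = (\<Sum>i<m. (row_dot d \<omega> t i u)\<^sup>2)"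

lemma measurable_row_dot [measurable]:
  "(\<lambda>\<omega>. row_dot d \<omega> t i u) \<in> borel_measurable design_space"
  unfolding row_dot_def
  by (intro borel_measurable_sum borel_measurable_times measurable_design_coordinate) simp

lemma measurable_design_form [measurable]:
  "(\<lambda>\<omega>. design_form d m \<omega> t u) \<in> borel_measurable design_space"
  unfolding design_form_def by measurable

lemma row_dot_distributed:
  assumes u: "(\<Sum>j<d. (u j)\<^sup>2) = 1"
  shows "distributed design_space lborel (\<lambda>\<omega>. row_dot d \<omega> t i u) std_normal_density"
proof -
  \<comment> \<open>Zero coefficients are dropped because an affine image of a normal variable has a
    density only for a nonzero slope. Since the squares sum to 1, something remains.\<close>
  define J where "J = {j. j < d \<and> u j \<noteq> 0}"
  have J: "finite J" "(\<Sum>j\<in>J. (u j)\<^sup>2) = 1"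
    unfolding u[symmetric] J_def by (auto intro!: sum.mono_neutral_left)
  then have "J \<noteq> {}"
    by auto
  have coord: "distributed design_space lborel (\<lambda>\<omega>. \<omega> k) std_normal_density" for k
    using distr_design_coordinate[of k]
    by (simp add: distributed_def std_gauss_def measurable_design_coordinate cong: distr_cong)
  \<comment> \<open>The entries of one row form disjoint singleton blocks of coordinates, so
    functions of them are independent. The summand 0 added below gives the shape of an affine
    map.\<close>
  have "ds.indep_vars (\<lambda>j. PiM {(t, i, j)} (\<lambda>_. borel)) (\<lambda>j \<omega>. restrict (\<lambda>k. \<omega> k) {(t, i, j)}) J"
    by (intro ds.indep_vars_restrict[OF indep_design_coordinates])
       (auto simp: disjoint_family_on_def)
  then have "ds.indep_vars (\<lambda>_. borel)
      (\<lambda>j \<omega>. 0 + u j * restrict (\<lambda>k. \<omega> k) {(t, i, j)} (t, i, j)) J"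
    by (rule ds.indep_vars_compose2) measurable
  then have "ds.indep_vars (\<lambda>_. borel) (\<lambda>j \<omega>. 0 + u j * \<omega> (t, i, j)) J"
    by simp
  moreover have "distributed design_space lborel (\<lambda>\<omega>. 0 + u j * \<omega> (t, i, j)) (normal_density (0 + u j * 0) (\<bar>u j\<bar> * 1))"
    if "j \<in> J" for j
    using that by (intro ds.normal_density_affine coord) (auto simp: J_def)
  ultimately have "distributed design_space lborel (\<lambda>\<omega>. \<Sum>j\<in>J. 0 + u j * \<omega> (t, i, j))
      (normal_density (\<Sum>j\<in>J. 0 + u j * 0) (sqrt (\<Sum>j\<in>J. (\<bar>u j\<bar> * 1)\<^sup>2)))"
    using J \<open>J \<noteq> {}\<close> by (intro ds.sum_indep_normal) (auto simp: J_def)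
  moreover have "(\<Sum>j\<in>J. 0 + u j * \<omega> (t, i, j)) = row_dot d \<omega> t i u" for \<omega>
    unfolding row_dot_def J_def by (intro sum.mono_neutral_cong_left) (auto simp: mult.commute)
  ultimately show ?thesis
    using J by simp
qed

text \<open>The exponential of the sum is a product over rows. Different rows read disjoint blocks
  of entries, so the expectation factorises, and each factor is the one-dimensional Gaussian
  integral.\<close>

lemma nn_integral_exp_design_form:
  fixes a :: real
  assumes u: "(\<Sum>j<d. (u j)\<^sup>2) = 1" and a: "1 + 2 * a > 0"
  shows "(\<integral>\<^sup>+\<omega>. ennreal (exp (- a * design_form d m \<omega> t u)) \<partial>design_space)
    = ennreal ((1 / sqrt (1 + 2 * a)) ^ m)"
proof -
  define K where "K i = (\<lambda>j. (t, i, j)) ` {..<d}" for i :: nat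
  have "ds.indep_vars (\<lambda>i. PiM (K i) (\<lambda>_. borel)) (\<lambda>i \<omega>. restrict (\<lambda>k. \<omega> k) (K i)) {..<m}"
    by (intro ds.indep_vars_restrict[OF indep_design_coordinates])
       (auto simp: K_def disjoint_family_on_def)
  then have "ds.indep_vars (\<lambda>_. borel)
      (\<lambda>i \<omega>. ennreal (exp (- a * (\<Sum>j<d. restrict (\<lambda>k. \<omega> k) (K i) (t, i, j) * u j)\<^sup>2))) {..<m}"
    by (rule ds.indep_vars_compose2) (measurable, auto simp: K_def)
  moreover have "(\<Sum>j<d. restrict (\<lambda>k. \<omega> k) (K i) (t, i, j) * u j) = row_dot d \<omega> t i u" for \<omega> i
    unfolding row_dot_def by (intro sum.cong) (auto simp: K_def)
  ultimately have indep: "ds.indep_vars (\<lambda>_. borel)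
      (\<lambda>i \<omega>. ennreal (exp (- a * (row_dot d \<omega> t i u)\<^sup>2))) {..<m}"
    by simp
  have "(\<lambda>x. ennreal (exp (- a * x\<^sup>2))) \<in> borel_measurable lborel"
    by measurable
  then have row: "(\<integral>\<^sup>+\<omega>. ennreal (exp (- a * (row_dot d \<omega> t i u)\<^sup>2)) \<partial>design_space)
      = ennreal (1 / sqrt (1 + 2 * a))" for i
    using distributed_nn_integral[OF row_dot_distributed[OF u, where t = t and i = i]]
      nn_integral_std_normal_exp_square[OF a]
    by simp
  have "(\<integral>\<^sup>+\<omega>. ennreal (exp (- a * design_form d m \<omega> t u)) \<partial>design_space)
      = (\<integral>\<^sup>+\<omega>. (\<Prod>i<m. ennreal (exp (- a * (row_dot d \<omega> t i u)\<^sup>2))) \<partial>design_space)"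
    by (simp add: design_form_def sum_distrib_left exp_sum prod_ennreal sum_negf[symmetric] del: sum_negf)
  also have "\<dots> = (\<Prod>i<m. \<integral>\<^sup>+\<omega>. ennreal (exp (- a * (row_dot d \<omega> t i u)\<^sup>2)) \<partial>design_space)"
    by (intro ds.indep_vars_nn_integral indep) auto
  also have "\<dots> = (\<Prod>i<m. ennreal (1 / sqrt (1 + 2 * a)))"
    by (intro prod.cong refl row)
  also have "\<dots> = ennreal ((1 / sqrt (1 + 2 * a)) ^ m)"
    using a by (simp add: ennreal_power)
  finally show ?thesis .
qed

text \<open>For \<open>a > 0\<close> this is a lower tail bound for the quadratic form, for \<open>a < 0\<close> an upper one.\<close>

lemma prob_design_form_tail:
  fixes a q s :: real
  assumes u: "(\<Sum>j<d. (u j)\<^sup>2) = 1" and a: "1 + 2 * a > 0"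
  shows "ds.prob {\<omega>. a * design_form d m \<omega> t u \<le> a * s * real m}
    \<le> (exp (a * s) / sqrt (1 + 2 * a)) ^ m"
proof -
  \<comment> \<open>Chernoff's method: the event says that the exponential of
    \<open>a * s * m - a * design_form\<close> is at least 1, so Markov's inequality
    applies.\<close>
  have "emeasure design_space {\<omega>. a * design_form d m \<omega> t u \<le> a * s * real m}
      = emeasure design_space {\<omega> \<in> space design_space. 1 \<le> ennreal (exp (a * s * real m))
          * ennreal (exp (- a * design_form d m \<omega> t u))}"
    by (intro arg_cong2[where f = emeasure] refl)
       (auto simp flip: ennreal_mult exp_add)
  also have "\<dots> \<le> ennreal (exp (a * s * real m))
      * (\<integral>\<^sup>+\<omega>. ennreal (exp (- a * design_form d m \<omega> t u)) * indicator (space design_space) \<omega> \<partial>design_space)"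
    using nn_integral_Markov_inequality[of "\<lambda>\<omega>. ennreal (exp (- a * design_form d m \<omega> t u))" "space design_space" design_space "ennreal (exp (a * s * real m))"]
    by (auto simp del: space_design_space)
  also have "\<dots> = ennreal (exp (a * s * real m) * (1 / sqrt (1 + 2 * a)) ^ m)"
    using a nn_integral_exp_design_form[OF u a] by (simp add: ennreal_mult)
  also have "exp (a * s * real m) * (1 / sqrt (1 + 2 * a)) ^ m = (exp (a * s) / sqrt (1 + 2 * a)) ^ m"
    by (simp add: power_divide exp_of_nat_mult mult.commute flip: exp_of_nat_mult)
  finally show ?thesis
    using a by (simp add: ds.emeasure_eq_measure)
qed

text \<open>The tail bound with \<open>a = 1\<close> and \<open>s = 1/4\<close>: its base
  \<open>exp (1/4) / sqrt 3\<close> is at most \<open>exp (- 1/4)\<close> because e is at most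
  3.\<close>

lemma prob_design_form_lower:
  assumes u: "(\<Sum>j<d. (u j)\<^sup>2) = 1"
  shows "ds.prob {\<omega>. design_form d m \<omega> t u \<le> real m / 4} \<le> exp (- real m / 4)"
proof -
  have "exp (1 / 2) \<le> sqrt (3::real)"
    using exp_le by (intro real_le_rsqrt) (simp flip: exp_double)
  then have "exp (1 / 4) / sqrt 3 \<le> exp (- (1 / 4) :: real)"
    by (simp add: exp_minus field_simps flip: exp_add)
  then have "(exp (1 / 4) / sqrt 3) ^ m \<le> exp (- (1 / 4) :: real) ^ m"
    by (intro power_mono) auto
  then show ?thesis
    using prob_design_form_tail[OF u, of 1 m t "1/4"]
    by (simp add: exp_of_nat_mult[symmetric])
qed

text \<open>The tail bound with \<open>a = - 1/4\<close> and \<open>s = 4\<close>: its base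
  \<open>exp (- 1) * sqrt 2\<close> is at most \<open>exp (- 1/4)\<close> because
  \<open>sqrt 2\<close> is at most \<open>7/4\<close>, hence at most
  \<open>exp (3/4)\<close>.\<close>

lemma prob_design_form_upper:
  assumes u: "(\<Sum>j<d. (u j)\<^sup>2) = 1"
  shows "ds.prob {\<omega>. real m * 4 \<le> design_form d m \<omega> t u} \<le> exp (- real m / 4)"
proof -
  have "sqrt 2 \<le> (1 + 3 / 4 :: real)"
    by (rule real_le_lsqrt) (simp_all add: power2_eq_square)
  also have "\<dots> \<le> exp (3 / 4)"
    by (rule exp_ge_add_one_self)
  finally have "exp (- 1) * sqrt 2 \<le> exp (- 1) * exp (3 / 4 :: real)"
    by simp
  then have "exp (- 1) / sqrt (1 / 2) \<le> exp (- (1 / 4) :: real)"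
    by (simp add: real_sqrt_divide flip: exp_add)
  then have "(exp (- 1) / sqrt (1 / 2)) ^ m \<le> exp (- (1 / 4) :: real) ^ m"
    by (intro power_mono) auto
  then show ?thesis
    using prob_design_form_tail[OF u, of "- 1/4" m t 4]
    by (simp add: exp_of_nat_mult[symmetric])
qed

subsection \<open>A uniform lower bound for the quadratic form\<close>

text \<open>Cut space into grid cells of side \<open>\<eta>\<close>. Coordinates of unit vectors lie
  between -1 and 1, so finitely many cells meet the sphere. Picking one sphere point per such cell
  gives the net, since points of one cell differ by less than \<open>\<eta>\<close> in each
  coordinate.\<close>

lemma sphere_net:
  fixes \<eta> :: real
  assumes "\<eta> > 0"
  obtains N :: "(nat \<Rightarrow> real) set" where "finite N" "\<And>u. u \<in> N \<Longrightarrow> (\<Sum>j<d. (u j)\<^sup>2) = 1"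
    "\<And>v. (\<Sum>j<d. (v j)\<^sup>2) = 1 \<Longrightarrow> \<exists>u\<in>N. \<forall>j<d. \<bar>u j - v j\<bar> < \<eta>"
proof -
  define S where "S = {u :: nat \<Rightarrow> real. (\<Sum>j<d. (u j)\<^sup>2) = 1}"
  \<comment> \<open>Restricting to indices below \<open>d\<close> places the cells in a finite
    extensional function space.\<close>
  define cell where "cell u = (\<lambda>j\<in>{..<d}. \<lfloor>u j / \<eta>\<rfloor>)" for u :: "nat \<Rightarrow> real"
  have "cell u \<in> {..<d} \<rightarrow>\<^sub>E {\<lfloor>- 1 / \<eta>\<rfloor>..\<lfloor>1 / \<eta>\<rfloor>}" if "u \<in> S" for u
  proof -
    have "- 1 \<le> u j \<and> u j \<le> 1" if "j < d" for j
    proof -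
      have "(u j)\<^sup>2 \<le> (\<Sum>j<d. (u j)\<^sup>2)"
        using that by (intro member_le_sum) auto
      then have "\<bar>u j\<bar> \<le> 1"
        using \<open>u \<in> S\<close> by (simp add: S_def abs_square_le_1)
      then show ?thesis
        by auto
    qed
    then have "- 1 / \<eta> \<le> u j / \<eta> \<and> u j / \<eta> \<le> 1 / \<eta>" if "j < d" for j
      using that assms by (intro conjI divide_right_mono) auto
    then show ?thesis
      by (auto simp: cell_def simp del: minus_divide_left intro!: floor_mono)
  qed
  then have "cell ` S \<subseteq> {..<d} \<rightarrow>\<^sub>E {\<lfloor>- 1 / \<eta>\<rfloor>..\<lfloor>1 / \<eta>\<rfloor>}"
    by (rule image_subsetI)
  then have "finite (cell ` S)"
    by (rule finite_subset) (simp add: finite_PiE)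
  then obtain N where N: "N \<subseteq> S" "finite N" "cell ` S = cell ` N"
    using finite_subset_image[of "cell ` S" cell S] by auto
  have "\<exists>u\<in>N. \<forall>j<d. \<bar>u j - v j\<bar> < \<eta>" if "v \<in> S" for v
  proof -
    have "cell v \<in> cell ` N"
      using that unfolding N(3)[symmetric] by (rule imageI)
    then obtain u where u: "u \<in> N" "cell u = cell v"
      by (elim imageE) simp
    have "\<bar>u j - v j\<bar> < \<eta>" if "j < d" for j
    proof -
      have "\<lfloor>u j / \<eta>\<rfloor> = \<lfloor>v j / \<eta>\<rfloor>"
        using fun_cong[OF u(2), of j] that by (simp add: cell_def)
      then have "\<bar>u j / \<eta> - v j / \<eta>\<bar> < 1"
        by linarith
      then show ?thesis
        using assms by (simp add: field_simps flip: diff_divide_distrib)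
    qed
    then show ?thesis
      using u by blast
  qed
  then show ?thesis
    using that[of N] N by (auto simp: S_def)
qed

lemma design_form_nonneg: "design_form d m \<omega> t u \<ge> 0"
  by (simp add: design_form_def sum_nonneg)

lemma sqrt_design_form: "sqrt (design_form d m \<omega> t u) = L2_set (\<lambda>i. row_dot d \<omega> t i u) {..<m}"
  by (simp add: design_form_def L2_set_def)

lemma sqrt_design_form_triangle:
  "sqrt (design_form d m \<omega> t u)
    \<le> sqrt (design_form d m \<omega> t v) + sqrt (design_form d m \<omega> t (\<lambda>j. u j - v j))"
proof -
  have "row_dot d \<omega> t i u = row_dot d \<omega> t i v + row_dot d \<omega> t i (\<lambda>j. u j - v j)" for i
    by (simp add: row_dot_def algebra_simps sum_subtractf)
  then show ?thesis
    unfolding sqrt_design_form by (simp only: L2_set_triangle_ineq)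
qed

lemma design_form_scale: "design_form d m \<omega> t (\<lambda>j. r * u j) = r\<^sup>2 * design_form d m \<omega> t u"
proof -
  have "row_dot d \<omega> t i (\<lambda>j. r * u j) = r * row_dot d \<omega> t i u" for i
    by (simp add: row_dot_def sum_distrib_left algebra_simps)
  then show ?thesis
    by (simp add: design_form_def sum_distrib_left power_mult_distrib)
qed

abbreviation unit_coord :: "nat \<Rightarrow> nat \<Rightarrow> real" where
  "unit_coord j \<equiv> (\<lambda>k. of_bool (k = j))"

text \<open>The operator norm is at most the Frobenius norm: the first factor is the sum of all
  squared entries, and Cauchy-Schwarz is applied row by row.\<close>

lemma design_form_le_unit_coord:
  "design_form d m \<omega> t w \<le> (\<Sum>j<d. design_form d m \<omega> t (unit_coord j)) * (\<Sum>j<d. (w j)\<^sup>2)"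
proof -
  have "row_dot d \<omega> t i (unit_coord j) = \<omega> (t, i, j)" if "j < d" for i j
    using that by (simp add: row_dot_def)
  then have "(\<Sum>j<d. design_form d m \<omega> t (unit_coord j)) = (\<Sum>i<m. \<Sum>j<d. (\<omega> (t, i, j))\<^sup>2)"
    unfolding design_form_def by (subst sum.swap) simp
  moreover have "(row_dot d \<omega> t i w)\<^sup>2 \<le> (\<Sum>j<d. (\<omega> (t, i, j))\<^sup>2) * (\<Sum>j<d. (w j)\<^sup>2)" for i
    unfolding row_dot_def by (rule Cauchy_Schwarz_ineq_sum)
  ultimately show ?thesis
    unfolding design_form_def by (simp add: sum_distrib_right sum_mono)
qed

text \<open>The mesh makes the squared distance from \<open>v\<close> to its net point
  \<open>u\<close> at most \<open>1 / (64 * d)\<close>, while the squared Frobenius norm is at most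
  \<open>4 * m * d\<close>. So the form at \<open>u - v\<close> is at most \<open>m / 16\<close>,
  and the triangle inequality leaves \<open>sqrt m / 2 - sqrt m / 4\<close> for
  \<open>v\<close>.\<close>

lemma design_form_lower_of_net:
  assumes "d \<ge> 1"
    and v: "(\<Sum>j<d. (v j)\<^sup>2) = 1"
    and net: "\<And>v. (\<Sum>j<d. (v j)\<^sup>2) = 1 \<Longrightarrow> \<exists>u\<in>N. \<forall>j<d. \<bar>u j - v j\<bar> < 1 / (8 * real d)"
    and lower: "\<And>u. u \<in> N \<Longrightarrow> real m / 4 \<le> design_form d m \<omega> t u"
    and upper: "\<And>j. j < d \<Longrightarrow> design_form d m \<omega> t (unit_coord j) \<le> real m * 4"
  shows "real m / 16 \<le> design_form d m \<omega> t v"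
proof -
  obtain u where u: "u \<in> N" "\<And>j. j < d \<Longrightarrow> \<bar>u j - v j\<bar> < 1 / (8 * real d)"
    using net[OF v] by blast
  have "(u j - v j)\<^sup>2 \<le> (1 / (8 * real d))\<^sup>2" if "j < d" for j
    using u(2)[OF that] by (simp add: abs_le_square_iff[symmetric])
  then have "(\<Sum>j<d. (u j - v j)\<^sup>2) \<le> (\<Sum>j<d. (1 / (8 * real d))\<^sup>2)"
    by (intro sum_mono) simp
  moreover have "(\<Sum>j<d. design_form d m \<omega> t (unit_coord j)) \<le> (\<Sum>j<d. real m * 4)"
    by (intro sum_mono upper) simp
  ultimately have "(\<Sum>j<d. design_form d m \<omega> t (unit_coord j)) * (\<Sum>j<d. (u j - v j)\<^sup>2)
      \<le> (\<Sum>j<d. real m * 4) * (\<Sum>j<d. (1 / (8 * real d))\<^sup>2)"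
    by (intro mult_mono sum_nonneg) auto
  also have "\<dots> = real m / 16"
    using \<open>d \<ge> 1\<close> by (simp add: field_simps power2_eq_square)
  finally have "design_form d m \<omega> t (\<lambda>j. u j - v j) \<le> real m / 16"
    by (rule order_trans[OF design_form_le_unit_coord])
  then have "sqrt (design_form d m \<omega> t (\<lambda>j. u j - v j)) \<le> sqrt (real m) / 4"
    using real_sqrt_le_mono[of _ "real m / 16"] by (simp add: real_sqrt_divide)
  moreover have "sqrt (real m) / 2 \<le> sqrt (design_form d m \<omega> t u)"
    using real_sqrt_le_mono[OF lower[OF u(1)]] by (simp add: real_sqrt_divide)
  ultimately have "sqrt (real m / 16) \<le> sqrt (design_form d m \<omega> t v)"
    using sqrt_design_form_triangle[of d m \<omega> t u v] by (simp add: real_sqrt_divide)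
  then show ?thesis
    by simp
qed

lemma design_form_homogeneous_lower:
  assumes "\<And>v. (\<Sum>j<d. (v j)\<^sup>2) = 1 \<Longrightarrow> b \<le> design_form d m \<omega> t v"
  shows "b * (\<Sum>j<d. (w j)\<^sup>2) \<le> design_form d m \<omega> t w"
proof (cases "(\<Sum>j<d. (w j)\<^sup>2) = 0")
  case False
  define r where "r = sqrt (\<Sum>j<d. (w j)\<^sup>2)"
  have r: "r\<^sup>2 = (\<Sum>j<d. (w j)\<^sup>2)" "r\<^sup>2 > 0"
    using False by (simp_all add: r_def sum_nonneg order.not_eq_order_implies_strict)
  have "(\<Sum>j<d. (1 / r * w j)\<^sup>2) = 1"
    using r by (simp add: power_mult_distrib power_divide flip: sum_divide_distrib)
  then have "b \<le> (1 / r)\<^sup>2 * design_form d m \<omega> t w"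
    using assms by (metis design_form_scale)
  then show ?thesis
    using r by (simp add: power_divide field_simps)
qed (simp add: design_form_nonneg)

text \<open>A union bound over the net points and the \<open>d\<close> columns. The net is fixed
  before \<open>m\<close> and \<open>t\<close>, so \<open>F = card N + d\<close> serves all of them.
  The set \<open>B\<close> only has to contain the failures: this avoids measurability of a
  condition on uncountably many \<open>w\<close>.\<close>

lemma design_form_lower_event:
  assumes "d \<ge> 1"
  obtains F :: real where "F \<ge> 0"
    "\<And>m t. \<exists>B\<in>ds.events. ds.prob B \<le> F * exp (- real m / 4) \<and>
      (\<forall>\<omega> w. \<omega> \<notin> B \<longrightarrow> real m / 16 * (\<Sum>j<d. (w j)\<^sup>2) \<le> design_form d m \<omega> t w)"
proof -
  obtain N :: "(nat \<Rightarrow> real) set" where N: "finite N" "\<And>u. u \<in> N \<Longrightarrow> (\<Sum>j<d. (u j)\<^sup>2) = 1"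
    "\<And>v. (\<Sum>j<d. (v j)\<^sup>2) = 1 \<Longrightarrow> \<exists>u\<in>N. \<forall>j<d. \<bar>u j - v j\<bar> < 1 / (8 * real d)"
    using sphere_net[of "1 / (8 * real d)" d] assms by auto
  have "\<exists>B\<in>ds.events. ds.prob B \<le> (card N + d) * exp (- real m / 4) \<and>
      (\<forall>\<omega> w. \<omega> \<notin> B \<longrightarrow> real m / 16 * (\<Sum>j<d. (w j)\<^sup>2) \<le> design_form d m \<omega> t w)" for m t
  proof -
    have unit_coord: "(\<Sum>k<d. (unit_coord j k)\<^sup>2) = 1" if "j < d" for j
      using that by (simp add: power2_eq_square flip: of_bool_conj)
    define B1 where "B1 u = {\<omega>. design_form d m \<omega> t u \<le> real m / 4}" for u
    define B2 where "B2 j = {\<omega>. real m * 4 \<le> design_form d m \<omega> t (unit_coord j)}" for j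
    have "{\<omega> \<in> space design_space. design_form d m \<omega> t u \<le> real m / 4} \<in> ds.events"
      "{\<omega> \<in> space design_space. real m * 4 \<le> design_form d m \<omega> t (unit_coord j)} \<in> ds.events" for u j
      by measurable
    then have meas: "B1 u \<in> ds.events" "B2 j \<in> ds.events" for u j
      unfolding B1_def B2_def by simp_all
    define B where "B = (\<Union>u\<in>N. B1 u) \<union> (\<Union>j<d. B2 j)"
    have "B \<in> ds.events"
      unfolding B_def using meas N(1) by (intro sets.Un sets.finite_UN) auto
    moreover have "ds.prob B \<le> (card N + d) * exp (- real m / 4)"
    proof -
      have "ds.prob B \<le> ds.prob (\<Union>u\<in>N. B1 u) + ds.prob (\<Union>j<d. B2 j)"
        unfolding B_def using meas N(1) by (intro measure_Un_le sets.finite_UN) auto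
      also have "\<dots> \<le> (\<Sum>u\<in>N. ds.prob (B1 u)) + (\<Sum>j<d. ds.prob (B2 j))"
        using meas N(1) by (intro add_mono measure_UNION_le) auto
      also have "\<dots> \<le> (\<Sum>u\<in>N. exp (- real m / 4)) + (\<Sum>j<d. exp (- real m / 4))"
        unfolding B1_def B2_def
        by (intro add_mono sum_mono prob_design_form_lower prob_design_form_upper)
           (simp_all add: N(2) unit_coord)
      finally show ?thesis
        by (simp add: algebra_simps)
    qed
    moreover have "real m / 16 * (\<Sum>j<d. (w j)\<^sup>2) \<le> design_form d m \<omega> t w" if "\<omega> \<notin> B" for \<omega> w
      using that
      by (intro design_form_homogeneous_lower design_form_lower_of_net[OF assms _ N(3)])
         (auto simp: B_def B1_def B2_def not_le intro: less_imp_le)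
    ultimately show ?thesis
      by blast
  qed
  then show ?thesis
    by (intro that[of "card N + d"]) auto
qed

subsection \<open>The mean recursion\<close>

lemma norm2_L2_set: "norm2 v = L2_set (\<lambda>i. vec_index v i) {..<dim_vec v}"
  by (simp add: norm2_def L2_set_def)

lemma norm2_nonneg: "norm2 v \<ge> 0"
  by (simp add: norm2_L2_set L2_set_nonneg)

lemma scalar_prod_self_norm2: "scalar_prod v v = (norm2 v)\<^sup>2"
  by (simp add: norm2_def scalar_prod_def sum_nonneg atLeast0LessThan power2_eq_square)

lemma norm2_eq_0: "norm2 v = 0 \<Longrightarrow> v = 0\<^sub>v (dim_vec v)"
  by (intro eq_vecI) (auto simp: norm2_L2_set L2_set_eq_0_iff)

lemma norm2_triangle:
  assumes "u \<in> carrier_vec n" "v \<in> carrier_vec n"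
  shows "norm2 (u + v) \<le> norm2 u + norm2 v"
proof -
  have "norm2 (u + v) = L2_set (\<lambda>i. vec_index u i + vec_index v i) {..<n}"
    using assms by (auto simp: norm2_L2_set intro!: L2_set_cong)
  then show ?thesis
    using assms L2_set_triangle_ineq by (auto simp: norm2_L2_set)
qed

lemma norm2_minus_commute:
  assumes "u \<in> carrier_vec n" "v \<in> carrier_vec n"
  shows "norm2 (u - v) = norm2 (v - u)"
  using assms by (simp add: norm2_def power2_commute)

lemma scalar_prod_le_norm2:
  assumes "u \<in> carrier_vec n" "v \<in> carrier_vec n"
  shows "scalar_prod u v \<le> norm2 u * norm2 v"
proof -
  have "scalar_prod u v \<le> (\<Sum>i<n. \<bar>vec_index u i\<bar> * \<bar>vec_index v i\<bar>)"
    using assms by (auto simp: scalar_prod_def atLeast0LessThan abs_mult[symmetric] intro!: sum_mono)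
  also have "\<dots> \<le> norm2 u * norm2 v"
    using assms L2_set_mult_ineq[of "vec_index u" "vec_index v" "{..<n}"] by (simp add: norm2_L2_set)
  finally show ?thesis .
qed

text \<open>Pairing \<open>e = w + M w\<close> with \<open>w\<close> and using Cauchy-Schwarz bounds
  both \<open>|w|^2\<close> and the quadratic form by \<open>|w| |e|\<close>, which gives the first
  two claims. For the third, \<open>e - w = M w\<close>, and the expansion of
  \<open>|w + M w|^2\<close> has a nonnegative cross term.\<close>

lemma resolvent_norm_bounds:
  assumes M: "M \<in> carrier_mat n n" and w: "w \<in> carrier_vec n"
    and e: "e = (1\<^sub>m n + M) *\<^sub>v w"
    and "\<alpha> \<ge> 0" and quad: "\<alpha> * (norm2 w)\<^sup>2 \<le> scalar_prod w (M *\<^sub>v w)"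
  shows "\<alpha> * norm2 w \<le> norm2 e" and "norm2 w \<le> norm2 e" and "norm2 (e - w) \<le> norm2 e"
proof -
  define v where "v = M *\<^sub>v w"
  have v: "v \<in> carrier_vec n"
    using M w by (simp add: v_def)
  have ewv: "e = w + v"
    using M w by (simp add: e v_def add_mult_distrib_mat_vec[of _ n n])
  have wv: "\<alpha> * (norm2 w)\<^sup>2 \<le> scalar_prod w v"
    using quad by (simp only: v_def)
  moreover have "0 \<le> \<alpha> * (norm2 w)\<^sup>2"
    using \<open>\<alpha> \<ge> 0\<close> by simp
  ultimately have wv_nonneg: "0 \<le> scalar_prod w v"
    by linarith
  have "(norm2 w)\<^sup>2 + scalar_prod w v = scalar_prod w e"
    using w v by (simp add: ewv scalar_prod_add_distrib[of _ n] scalar_prod_self_norm2)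
  then have cs: "(norm2 w)\<^sup>2 + scalar_prod w v \<le> norm2 w * norm2 e"
    using w v scalar_prod_le_norm2[of w n e] by (simp add: ewv)
  have "norm2 w * (\<alpha> * norm2 w) = \<alpha> * (norm2 w)\<^sup>2"
    by (simp add: power2_eq_square)
  also have "\<dots> \<le> norm2 w * norm2 e"
    using cs wv zero_le_power2[of "norm2 w"] by linarith
  finally have "norm2 w * (\<alpha> * norm2 w) \<le> norm2 w * norm2 e" .
  then show "\<alpha> * norm2 w \<le> norm2 e"
    using norm2_nonneg[of w] norm2_nonneg[of e] by (cases "norm2 w = 0") auto
  have "norm2 w * norm2 w \<le> norm2 w * norm2 e"
    using cs wv_nonneg by (simp add: power2_eq_square)
  then show "norm2 w \<le> norm2 e"
    using norm2_nonneg[of w] norm2_nonneg[of e] by (cases "norm2 w = 0") auto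
  have "e - w = v"
    using w v unfolding ewv by (intro eq_vecI) auto
  have "(norm2 e)\<^sup>2 = (norm2 w)\<^sup>2 + 2 * scalar_prod w v + (norm2 v)\<^sup>2"
    using w v by (simp add: ewv scalar_prod_add_distrib[of _ n] add_scalar_prod_distrib[of _ n]
        comm_scalar_prod[of v n w] flip: scalar_prod_self_norm2)
  then have "(norm2 v)\<^sup>2 \<le> (norm2 e)\<^sup>2"
    using wv_nonneg by simp
  then show "norm2 (e - w) \<le> norm2 e"
    unfolding \<open>e - w = v\<close> by (rule power2_le_imp_le) (rule norm2_nonneg)
qed

section \<open>The matrices of the recursion and their inverses\<close>

lemma smult_mat_mult_vec:
  fixes A :: "'a :: comm_ring_1 mat"
  assumes "A \<in> carrier_mat n k" "v \<in> carrier_vec k"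
  shows "(c \<cdot>\<^sub>m A) *\<^sub>v v = c \<cdot>\<^sub>v (A *\<^sub>v v)"
  using assms by (intro eq_vecI) (auto simp: scalar_prod_def sum_distrib_left mult.assoc)

lemma Mmat_carrier [simp]: "Mmat d sg sbar m \<omega> t \<in> carrier_mat d d"
  by (rule carrier_matI) (simp_all add: Mmat_def design_def)

text \<open>Moving the transpose across the scalar product turns the form of the Gram matrix into
  the squared norm of \<open>X w\<close>. This connects the matrix recursion with the coordinatewise
  probability bounds.\<close>

lemma Mmat_quadratic_form:
  assumes w: "w \<in> carrier_vec d"
  shows "scalar_prod w (Mmat d sg sbar m \<omega> t *\<^sub>v w)
    = (sbar / sg)\<^sup>2 * design_form d (m t) \<omega> t (vec_index w)"
proof -
  let ?X = "design d (m t) \<omega> t"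
  have X: "?X \<in> carrier_mat (m t) d"
    by (simp add: design_def)
  have Xw: "?X *\<^sub>v w \<in> carrier_vec (m t)"
    using X w by simp
  have "Mmat d sg sbar m \<omega> t *\<^sub>v w = (sbar / sg)\<^sup>2 \<cdot>\<^sub>v (transpose_mat ?X *\<^sub>v (?X *\<^sub>v w))"
    unfolding Mmat_def using X w
    by (simp add: smult_mat_mult_vec[of _ d d] assoc_mult_mat_vec[of _ d "m t" _ d])
  then have "scalar_prod w (Mmat d sg sbar m \<omega> t *\<^sub>v w)
      = (sbar / sg)\<^sup>2 * scalar_prod (transpose_mat ?X *\<^sub>v (?X *\<^sub>v w)) w"
    using X w by (simp add: comm_scalar_prod[of w d])
  also have "scalar_prod (transpose_mat ?X *\<^sub>v (?X *\<^sub>v w)) w = (norm2 (?X *\<^sub>v w))\<^sup>2"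
    using transpose_vec_mult_scalar[OF X w Xw] by (simp add: scalar_prod_self_norm2)
  also have "\<dots> = design_form d (m t) \<omega> t (vec_index w)"
  proof -
    have "vec_index (?X *\<^sub>v w) i = row_dot d \<omega> t i (vec_index w)" if "i < m t" for i
      using w that by (auto simp: row_dot_def design_def scalar_prod_def atLeast0LessThan intro!: sum.cong)
    moreover have "dim_vec (?X *\<^sub>v w) = m t"
      using X by simp
    ultimately show ?thesis
      by (simp add: norm2_def design_form_def sum_nonneg)
  qed
  finally show ?thesis .
qed

text \<open>A kernel vector satisfies the resolvent estimate with \<open>e = 0\<close>, so its norm
  is 0.\<close>

lemma one_plus_Mmat_det: "det (1\<^sub>m d + Mmat d sg sbar m \<omega> t) \<noteq> 0"
proof
  let ?A = "1\<^sub>m d + Mmat d sg sbar m \<omega> t"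
  assume "det ?A = 0"
  then obtain w where w: "w \<in> carrier_vec d" "w \<noteq> 0\<^sub>v d" "?A *\<^sub>v w = 0\<^sub>v d"
    using det_0_iff_vec_prod_zero_field[of ?A d] by auto
  have "norm2 w \<le> norm2 (0\<^sub>v d)"
    by (rule resolvent_norm_bounds(2)[OF Mmat_carrier w(1) w(3)[symmetric], of 0])
       (simp_all add: Mmat_quadratic_form w design_form_nonneg)
  also have "norm2 (0\<^sub>v d) = 0"
    by (simp add: norm2_def)
  finally have "norm2 w = 0"
    using norm2_nonneg[of w] by simp
  then show False
    using norm2_eq_0[of w] w by auto
qed

text \<open>The adjugate formula exhibits the entries of the inverse as quotients of polynomials in
  the entries of \<open>A\<close>, which later yields measurability. It follows from uniqueness of
  the inverse.\<close>

lemma mat_inverse_nonzero_det: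
  fixes A :: "'a :: field mat"
  assumes A: "A \<in> carrier_mat n n" and "det A \<noteq> 0"
  shows "the (mat_inverse A) \<in> carrier_mat n n" "A * the (mat_inverse A) = 1\<^sub>m n"
    "the (mat_inverse A) = (1 / det A) \<cdot>\<^sub>m adj_mat A"
proof -
  have "A \<in> Units (ring_mat TYPE('a) n ())"
    by (rule det_non_zero_imp_unit) fact+
  then obtain B where B: "mat_inverse A = Some B"
    using mat_inverse(1)[OF A, of "()"] by auto
  note inv = mat_inverse(2)[OF A B]
  then show "the (mat_inverse A) \<in> carrier_mat n n" "A * the (mat_inverse A) = 1\<^sub>m n"
    by (simp_all add: B)
  note adj = adj_mat[OF A]
  have "A * ((1 / det A) \<cdot>\<^sub>m adj_mat A) = 1\<^sub>m n"
    using A adj assms(2) by (simp add: mult_smult_distrib[of _ n n])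
       (auto intro!: eq_matI)
  then have "B * (A * ((1 / det A) \<cdot>\<^sub>m adj_mat A)) = B"
    using inv right_mult_one_mat[of B n n] by simp
  moreover have "B * (A * ((1 / det A) \<cdot>\<^sub>m adj_mat A)) = (B * A) * ((1 / det A) \<cdot>\<^sub>m adj_mat A)"
    using inv A adj by (intro assoc_mult_mat[symmetric]) auto
  ultimately show "the (mat_inverse A) = (1 / det A) \<cdot>\<^sub>m adj_mat A"
    using inv adj by (simp add: B)
qed

section \<open>The drift of the mean\<close>

lemma Emu_carrier:
  assumes "dim_vec mubar = d" "dim_vec mu0 = d"
  shows "Emu d sg sbar mubar mu0 m \<omega> t \<in> carrier_vec d"
proof (induction t)
  case 0
  show ?case
    by (simp add: carrier_vecI assms(2))
next
  case (Suc t)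
  have "1\<^sub>m d + Mmat d sg sbar m \<omega> (Suc t) \<in> carrier_mat d d"
    by simp
  then have "the (mat_inverse (1\<^sub>m d + Mmat d sg sbar m \<omega> (Suc t))) \<in> carrier_mat d d"
    by (rule mat_inverse_nonzero_det(1)) (rule one_plus_Mmat_det)
  then show ?case
    unfolding Emu.simps
    by (rule mult_mat_vec_carrier)
       (intro add_carrier_vec mult_mat_vec_carrier[OF Mmat_carrier Suc] carrier_vecI assms(1))
qed

text \<open>With \<open>A = I + M\<close>, the recursion says that \<open>A\<close> maps the new
  mean to \<open>mubar + M x\<close>, where \<open>x\<close> is the old mean. Subtracting this from
  \<open>A x = x + M x\<close> cancels \<open>M x\<close>.\<close>

lemma Emu_resolvent:
  fixes d m \<omega> t sg sbar mubar mu0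
  defines "x \<equiv> Emu d sg sbar mubar mu0 m \<omega>"
  assumes dims: "dim_vec mubar = d" "dim_vec mu0 = d"
  shows "x t - mubar = (1\<^sub>m d + Mmat d sg sbar m \<omega> (Suc t)) *\<^sub>v (x t - x (Suc t))"
proof -
  define M where "M = Mmat d sg sbar m \<omega> (Suc t)"
  define A where "A = 1\<^sub>m d + M"
  have M: "M \<in> carrier_mat d d" and A: "A \<in> carrier_mat d d"
    by (simp_all add: M_def A_def)
  have mu: "mubar \<in> carrier_vec d"
    by (rule carrier_vecI) (rule dims)
  have x: "x s \<in> carrier_vec d" for s
    unfolding x_def by (rule Emu_carrier) (rule dims)+
  have inv: "the (mat_inverse A) \<in> carrier_mat d d" "A * the (mat_inverse A) = 1\<^sub>m d"
    using mat_inverse_nonzero_det(1,2)[OF A] one_plus_Mmat_det by (simp_all add: A_def M_def)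
  have "x (Suc t) = the (mat_inverse A) *\<^sub>v (mubar + M *\<^sub>v x t)"
    by (simp add: x_def A_def M_def)
  then have "A *\<^sub>v x (Suc t) = (A * the (mat_inverse A)) *\<^sub>v (mubar + M *\<^sub>v x t)"
    using A inv(1) M x mu by (simp add: assoc_mult_mat_vec[of _ d d _ d])
  also have "\<dots> = mubar + M *\<^sub>v x t"
    using M mu x by (simp add: inv)
  finally have "A *\<^sub>v (x t - x (Suc t)) = A *\<^sub>v x t - (mubar + M *\<^sub>v x t)"
    using A x by (simp add: mult_minus_distrib_mat_vec[of _ d d])
  also have "A *\<^sub>v x t = x t + M *\<^sub>v x t"
    using M x by (simp add: A_def add_mult_distrib_mat_vec[of _ d d])
  also have "x t + M *\<^sub>v x t - (mubar + M *\<^sub>v x t) = x t - mubar"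
    using M x[of t] mu by (intro eq_vecI) auto
  finally show ?thesis
    by (simp add: A_def M_def)
qed

text \<open>The resolvent estimate for \<open>w = x t - x (Suc t)\<close> and
  \<open>e = x t - mubar\<close>, so that \<open>e - w\<close> is the next deviation from
  \<open>mubar\<close>.\<close>

lemma Emu_step_bounds:
  fixes d m \<omega> t sg sbar mubar mu0
  defines "x \<equiv> Emu d sg sbar mubar mu0 m \<omega>"
  assumes dims: "dim_vec mubar = d" "dim_vec mu0 = d"
    and b: "b \<ge> 0" "\<And>w. b * (\<Sum>j<d. (w j)\<^sup>2) \<le> design_form d (m (Suc t)) \<omega> (Suc t) w"
  shows "(sbar / sg)\<^sup>2 * b * norm2 (x (Suc t) - x t) \<le> norm2 (x t - mubar)"
    "norm2 (x (Suc t) - x t) \<le> norm2 (x t - mubar)"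
    "norm2 (x (Suc t) - mubar) \<le> norm2 (x t - mubar)"
proof -
  have mu: "mubar \<in> carrier_vec d"
    by (rule carrier_vecI) (rule dims)
  have x: "x s \<in> carrier_vec d" for s
    unfolding x_def by (rule Emu_carrier) (rule dims)+
  define w where "w = x t - x (Suc t)"
  have w: "w \<in> carrier_vec d"
    using x by (simp add: w_def)
  have "(norm2 w)\<^sup>2 = (\<Sum>j<d. (vec_index w j)\<^sup>2)"
    using w by (simp add: norm2_def sum_nonneg)
  then have "(sbar / sg)\<^sup>2 * b * (norm2 w)\<^sup>2
      \<le> scalar_prod w (Mmat d sg sbar m \<omega> (Suc t) *\<^sub>v w)"
    using mult_left_mono[OF b(2), of "(sbar / sg)\<^sup>2" "vec_index w"]
    by (simp add: Mmat_quadratic_form[OF w] mult.assoc)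
  note bounds = resolvent_norm_bounds[OF Mmat_carrier w _ _ this,
      OF Emu_resolvent[OF dims, where m = m and \<omega> = \<omega> and sg = sg and sbar = sbar,
        folded x_def, of t, folded w_def]]
  have "norm2 w = norm2 (x (Suc t) - x t)"
    unfolding w_def by (rule norm2_minus_commute) (rule x)+
  moreover have "x t - mubar - w = x (Suc t) - mubar"
    using mu x[of t] x[of "Suc t"] by (intro eq_vecI) (auto simp: w_def)
  ultimately show "(sbar / sg)\<^sup>2 * b * norm2 (x (Suc t) - x t) \<le> norm2 (x t - mubar)"
    "norm2 (x (Suc t) - x t) \<le> norm2 (x t - mubar)"
    "norm2 (x (Suc t) - mubar) \<le> norm2 (x t - mubar)"
    using bounds b(1) by simp_all
qed

text \<open>All means stay within \<open>r\<close> of \<open>mubar\<close>, so the first step bound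
  limits the increment in round \<open>s + 1\<close> by \<open>g s\<close>; the triangle inequality
  then adds the increments up.\<close>

lemma Emu_deviation_bound:
  fixes d m \<omega> sg sbar mubar mu0
  defines "x \<equiv> Emu d sg sbar mubar mu0 m \<omega>" and "r \<equiv> norm2 (mu0 - mubar)"
  assumes dims: "dim_vec mubar = d" "dim_vec mu0 = d"
    and b: "\<And>t. b t \<ge> 0"
      "\<And>t w. b t * (\<Sum>j<d. (w j)\<^sup>2) \<le> design_form d (m (Suc t)) \<omega> (Suc t) w"
    and g: "\<And>t. g t > 0" "\<And>t. r \<le> (sbar / sg)\<^sup>2 * b t * g t"
  shows "norm2 (x t - mu0) \<le> (\<Sum>s<t. g s)"
proof -
  note step = Emu_step_bounds[where d = d and m = m and \<omega> = \<omega> and sg = sg and sbar = sbar,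
      OF dims b, folded x_def]
  have x: "x s \<in> carrier_vec d" for s
    unfolding x_def by (rule Emu_carrier) (rule dims)+
  have r: "norm2 (x s - mubar) \<le> r" for s
  proof (induction s)
    case 0
    show ?case
      by (simp add: r_def x_def)
  next
    case (Suc s)
    show ?case
      by (rule order_trans[OF step(3) Suc])
  qed
  have inc: "norm2 (x (Suc s) - x s) \<le> g s" for s
  proof (cases "r = 0")
    \<comment> \<open>For \<open>r = 0\<close> the factor in front of the increment may vanish and
      cannot be cancelled. The second step bound shows that the mean does not move.\<close>
    case True
    then show ?thesis
      using order_trans[OF step(2) r, of s] g(1)[of s] by simp
  next
    case False
    have "r > 0"
      using False norm2_nonneg[of "mu0 - mubar"] by (simp add: r_def)
    then have "(sbar / sg)\<^sup>2 * b s * g s > 0"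
      using g(2)[of s] by simp
    then have pos: "(sbar / sg)\<^sup>2 * b s > 0"
      using g(1)[of s] by (simp add: zero_less_mult_iff)
    have "(sbar / sg)\<^sup>2 * b s * norm2 (x (Suc s) - x s) \<le> (sbar / sg)\<^sup>2 * b s * g s"
      using order_trans[OF step(1) r, of s] g(2)[of s] by simp
    then show ?thesis
      using pos by (simp only: mult_le_cancel_left_pos)
  qed
  show ?thesis
  proof (induction t)
    case 0
    show ?case
      by (simp add: x_def norm2_def)
  next
    case (Suc t)
    have "x (Suc t) - mu0 = (x (Suc t) - x t) + (x t - mu0)"
      using x[of t] x[of "Suc t"] dims by (intro eq_vecI) auto
    then have "norm2 (x (Suc t) - mu0) \<le> norm2 (x (Suc t) - x t) + norm2 (x t - mu0)"
      using x dims by (metis carrier_vec_dim_vec minus_carrier_vec norm2_triangle)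
    then show ?case
      using Suc inc[of t] by simp
  qed
qed

subsection \<open>Measurability\<close>

text \<open>By the Leibniz formula the determinant is a polynomial in the entries.\<close>

lemma det_measurable:
  fixes A :: "'a \<Rightarrow> real mat"
  assumes A: "\<And>\<omega>. A \<omega> \<in> carrier_mat n n"
    and meas: "\<And>i j. i < n \<Longrightarrow> j < n \<Longrightarrow> (\<lambda>\<omega>. A \<omega> $$ (i, j)) \<in> borel_measurable M"
  shows "(\<lambda>\<omega>. det (A \<omega>)) \<in> borel_measurable M"
proof -
  have "(\<lambda>\<omega>. \<Sum>p\<in>{p. p permutes {0..<n}}. signof p * (\<Prod>i = 0..<n. A \<omega> $$ (i, p i)))
      \<in> borel_measurable M"
  proof (intro borel_measurable_sum borel_measurable_times borel_measurable_prod meas)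
    fix p i assume "p \<in> {p. p permutes {0..<n}}" "i \<in> {0..<n}"
    then show "p i < n"
      using permutes_in_image[of p "{0..<n}" i] by simp
  qed auto
  then show ?thesis
    by (simp add: det_def'[OF A])
qed

lemma adj_mat_measurable:
  fixes A :: "'a \<Rightarrow> real mat"
  assumes A: "\<And>\<omega>. A \<omega> \<in> carrier_mat n n"
    and meas: "\<And>i j. i < n \<Longrightarrow> j < n \<Longrightarrow> (\<lambda>\<omega>. A \<omega> $$ (i, j)) \<in> borel_measurable M"
    and ij: "i < n" "j < n"
  shows "(\<lambda>\<omega>. adj_mat (A \<omega>) $$ (i, j)) \<in> borel_measurable M"
proof -
  have dims [simp]: "dim_row (A \<omega>) = n" "dim_col (A \<omega>) = n" for \<omega>
    using A[of \<omega>] by auto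
  have "(\<lambda>\<omega>. det (mat_delete (A \<omega>) j i)) \<in> borel_measurable M"
  proof (rule det_measurable)
    show "mat_delete (A \<omega>) j i \<in> carrier_mat (n - 1) (n - 1)" for \<omega>
      by (simp add: mat_delete_def)
    fix k l assume "k < n - 1" "l < n - 1"
    then show "(\<lambda>\<omega>. mat_delete (A \<omega>) j i $$ (k, l)) \<in> borel_measurable M"
      by (auto simp: mat_delete_def intro!: meas)
  qed
  then show ?thesis
    using ij by (simp add: adj_mat_def cofactor_def)
qed

lemma Mmat_measurable:
  assumes "i < d" "j < d"
  shows "(\<lambda>\<omega>. Mmat d sg sbar m \<omega> t $$ (i, j)) \<in> borel_measurable design_space"
proof -
  have "(\<lambda>\<omega>. (sbar / sg)\<^sup>2 * (\<Sum>k<m t. \<omega> (t, k, i) * \<omega> (t, k, j))) \<in> borel_measurable design_space"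
    by (intro borel_measurable_sum borel_measurable_times measurable_design_coordinate) simp
  moreover have "Mmat d sg sbar m \<omega> t $$ (i, j)
      = (sbar / sg)\<^sup>2 * (\<Sum>k<m t. \<omega> (t, k, i) * \<omega> (t, k, j))" for \<omega>
    using assms by (simp add: Mmat_def design_def scalar_prod_def atLeast0LessThan)
  ultimately show ?thesis
    by simp
qed

lemma mult_mat_vec_measurable:
  fixes A :: "'a \<Rightarrow> real mat" and v :: "'a \<Rightarrow> real Matrix.vec"
  assumes A: "\<And>\<omega>. A \<omega> \<in> carrier_mat n k" and v: "\<And>\<omega>. v \<omega> \<in> carrier_vec k"
    and "\<And>i j. i < n \<Longrightarrow> j < k \<Longrightarrow> (\<lambda>\<omega>. A \<omega> $$ (i, j)) \<in> borel_measurable M"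
    and "\<And>j. j < k \<Longrightarrow> (\<lambda>\<omega>. vec_index (v \<omega>) j) \<in> borel_measurable M"
    and i: "i < n"
  shows "(\<lambda>\<omega>. vec_index (A \<omega> *\<^sub>v v \<omega>) i) \<in> borel_measurable M"
proof -
  have "(\<lambda>\<omega>. \<Sum>j<k. A \<omega> $$ (i, j) * vec_index (v \<omega>) j) \<in> borel_measurable M"
    using assms by (intro borel_measurable_sum borel_measurable_times) auto
  moreover have "vec_index (A \<omega> *\<^sub>v v \<omega>) i = (\<Sum>j<k. A \<omega> $$ (i, j) * vec_index (v \<omega>) j)" for \<omega>
    using A[of \<omega>] v[of \<omega>] i by (simp add: scalar_prod_def atLeast0LessThan)
  ultimately show ?thesis
    by simp
qed

text \<open>By induction each mean is built from the entries by sums, products and a division by a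
  determinant, once the inverse is replaced by its adjugate formula.\<close>

lemma Emu_measurable:
  assumes dims: "dim_vec mubar = d" "dim_vec mu0 = d" and "i < d"
  shows "(\<lambda>\<omega>. vec_index (Emu d sg sbar mubar mu0 m \<omega> t) i) \<in> borel_measurable design_space"
  using \<open>i < d\<close>
proof (induction t arbitrary: i)
  case (Suc t)
  define M where "M \<omega> = Mmat d sg sbar m \<omega> (Suc t)" for \<omega>
  define A where "A \<omega> = 1\<^sub>m d + M \<omega>" for \<omega>
  define x where "x \<omega> = Emu d sg sbar mubar mu0 m \<omega> t" for \<omega>
  have M [simp]: "M \<omega> \<in> carrier_mat d d" and A: "A \<omega> \<in> carrier_mat d d"
    and x: "x \<omega> \<in> carrier_vec d" for \<omega>
    unfolding M_def A_def x_def using Emu_carrier[OF dims] by simp_all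
  have dimM [simp]: "dim_row (M \<omega>) = d" "dim_col (M \<omega>) = d" for \<omega>
    using M[of \<omega>] by (auto simp del: M)
  have M_meas: "(\<lambda>\<omega>. M \<omega> $$ (i, j)) \<in> borel_measurable design_space" if "i < d" "j < d" for i j
    unfolding M_def using that by (rule Mmat_measurable)
  have A_meas: "(\<lambda>\<omega>. A \<omega> $$ (i, j)) \<in> borel_measurable design_space" if "i < d" "j < d" for i j
  proof -
    have "A \<omega> $$ (i, j) = 1\<^sub>m d $$ (i, j) + M \<omega> $$ (i, j)" for \<omega>
      unfolding A_def using that by (intro index_add_mat) simp_all
    then show ?thesis
      by (simp only:) (intro borel_measurable_add borel_measurable_const M_meas that)
  qed
  have Mx: "(\<lambda>\<omega>. vec_index (M \<omega> *\<^sub>v x \<omega>) i) \<in> borel_measurable design_space" if "i < d" for i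
    by (rule mult_mat_vec_measurable[OF M x M_meas]) (simp_all add: x_def Suc.IH that)
  have inv: "the (mat_inverse (A \<omega>)) \<in> carrier_mat d d"
    "the (mat_inverse (A \<omega>)) = (1 / det (A \<omega>)) \<cdot>\<^sub>m adj_mat (A \<omega>)" for \<omega>
    using mat_inverse_nonzero_det[OF A] one_plus_Mmat_det by (simp_all add: A_def M_def)
  have inv_meas: "(\<lambda>\<omega>. the (mat_inverse (A \<omega>)) $$ (i, j)) \<in> borel_measurable design_space"
    if "i < d" "j < d" for i j
  proof -
    have "(\<lambda>\<omega>. 1 / det (A \<omega>) * adj_mat (A \<omega>) $$ (i, j)) \<in> borel_measurable design_space"
      using that
      by (intro borel_measurable_times borel_measurable_divide borel_measurable_const
          det_measurable[OF A A_meas] adj_mat_measurable[OF A A_meas])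
    moreover have "the (mat_inverse (A \<omega>)) $$ (i, j) = 1 / det (A \<omega>) * adj_mat (A \<omega>) $$ (i, j)" for \<omega>
      using adj_mat(1)[OF A, of \<omega>] that by (simp add: inv(2))
    ultimately show ?thesis
      by simp
  qed
  have "(\<lambda>\<omega>. vec_index (the (mat_inverse (A \<omega>)) *\<^sub>v (mubar + M \<omega> *\<^sub>v x \<omega>)) i)
      \<in> borel_measurable design_space"
  proof (rule mult_mat_vec_measurable[OF inv(1) _ inv_meas _ Suc.prems])
    show "mubar + M \<omega> *\<^sub>v x \<omega> \<in> carrier_vec d" for \<omega>
      by (intro add_carrier_vec mult_mat_vec_carrier[OF M x] carrier_vecI dims)
    show "(\<lambda>\<omega>. vec_index (mubar + M \<omega> *\<^sub>v x \<omega>) j) \<in> borel_measurable design_space" if "j < d" for j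
    proof -
      have "vec_index (mubar + M \<omega> *\<^sub>v x \<omega>) j = vec_index mubar j + vec_index (M \<omega> *\<^sub>v x \<omega>) j" for \<omega>
        using that by (intro index_add_vec) simp
      then show ?thesis
        by (simp only:) (intro borel_measurable_add borel_measurable_const Mx that)
    qed
  qed
  then show ?case
    unfolding A_def M_def x_def Emu.simps .
qed simp

text \<open>Monotonicity of the measure needs the larger set to be an event; a set outside the
  sigma-algebra would have \<open>measure\<close> 0 by convention.\<close>

lemma Emu_deviation_event:
  assumes dims: "dim_vec mubar = d" "dim_vec mu0 = d"
  shows "{\<omega> \<in> space design_space. \<forall>t\<ge>1. norm2 (Emu d sg sbar mubar mu0 m \<omega> t - mu0) \<le> delta}
    \<in> ds.events"
proof -
  have "norm2 (Emu d sg sbar mubar mu0 m \<omega> t - mu0)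
      = sqrt (\<Sum>i<d. (vec_index (Emu d sg sbar mubar mu0 m \<omega> t) i - vec_index mu0 i)\<^sup>2)" for \<omega> t
    using dims by (simp add: norm2_def)
  moreover have [measurable]:
    "(\<lambda>\<omega>. \<Sum>i<d. (vec_index (Emu d sg sbar mubar mu0 m \<omega> t) i - vec_index mu0 i)\<^sup>2)
      \<in> borel_measurable design_space" for t
    by (intro borel_measurable_sum borel_measurable_power borel_measurable_diff
        borel_measurable_const Emu_measurable[OF dims]) simp
  have "(\<lambda>\<omega>. sqrt (\<Sum>i<d. (vec_index (Emu d sg sbar mubar mu0 m \<omega> t) i - vec_index mu0 i)\<^sup>2))
      \<in> borel_measurable design_space" for t
    by measurable
  ultimately have [measurable]:
    "(\<lambda>\<omega>. norm2 (Emu d sg sbar mubar mu0 m \<omega> t - mu0)) \<in> borel_measurable design_space" for t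
    by simp
  show ?thesis
    by measurable
qed

subsection \<open>The sample size\<close>

text \<open>Both summands are nonnegative, so each bounds the sample size from below. As
  \<open>D * d\<close> is at least 12, a quarter of the sample size is at least three times the
  logarithm, which gives the cube.\<close>

lemma sample_size_lower:
  fixes D :: real
  assumes "D \<ge> 12" "d \<ge> 1" "r \<ge> 0" "delta > 0" "0 < eps" "eps < 1"
  shows "D * (r / delta) * (sg / sbar)\<^sup>2 * real t powr (1 + c)
      \<le> real (sample_size c D d r sg sbar delta eps t)"
    and "exp (- real (sample_size c D d r sg sbar delta eps t) / 4) \<le> (eps / (real t + 1)) ^ 3"
proof -
  let ?m = "real (sample_size c D d r sg sbar delta eps t)"
  define L where "L = ln ((real t + 1) / eps)"
  have "L \<ge> 0"
    using assms by (simp add: L_def)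
  moreover have "12 * 1 \<le> D * real d"
    using assms by (intro mult_mono) auto
  ultimately have L: "0 \<le> 12 * L" "12 * L \<le> D * real d * L"
    by (simp_all add: mult_right_mono)
  have p: "0 \<le> D * (r / delta) * (sg / sbar)\<^sup>2 * real t powr (1 + c)"
    using assms by simp
  have m: "D * (r / delta) * (sg / sbar)\<^sup>2 * real t powr (1 + c) + D * real d * L \<le> ?m"
    unfolding sample_size_def L_def by (rule real_nat_ceiling_ge)
  then show "D * (r / delta) * (sg / sbar)\<^sup>2 * real t powr (1 + c) \<le> ?m"
    using L by linarith
  have "- ?m / 4 \<le> real 3 * (- L)"
    using m L p by simp
  also have "- L = ln (eps / (real t + 1))"
    using assms by (simp add: L_def ln_div)
  finally have "exp (- ?m / 4) \<le> exp (real 3 * ln (eps / (real t + 1)))"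
    by simp
  also have "\<dots> = (eps / (real t + 1)) ^ 3"
    using assms by (simp only: exp_of_nat_mult) simp
  finally show "exp (- ?m / 4) \<le> (eps / (real t + 1)) ^ 3" .
qed

section \<open>Choice of constants and union over the rounds\<close>

theorem theorem5:
  fixes c :: real
  assumes "c > 0"
  shows "\<exists>D::real. \<forall>(d::nat) (sg::real) (sbar::real) (mubar::real vec) (mu0::real vec).
    d \<ge> 1 \<longrightarrow> dim_vec mubar = d \<longrightarrow> dim_vec mu0 = d \<longrightarrow> sg > 0 \<longrightarrow> sbar > 0 \<longrightarrow>
    (\<exists>delta0>0. \<exists>eps0>0. \<forall>delta eps. 0 < delta \<longrightarrow> delta < delta0 \<longrightarrow> 0 < eps \<longrightarrow> eps < eps0 \<longrightarrow>
      (let m = sample_size c D d (norm2 (mu0 - mubar)) sg sbar delta eps in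
        measure design_space
          {\<omega> \<in> space design_space. \<forall>t\<ge>1. norm2 (Emu d sg sbar mubar mu0 m \<omega> t - mu0) \<le> delta}
        > 1 - eps))"
proof -
  \<comment> \<open>\<open>z n\<close> is the reciprocal of the growth factor of \<open>m\<close> in
    round \<open>n + 1\<close>; it is summable because \<open>c > 0\<close>.\<close>
  define z where "z n = real (Suc n) powr - (1 + c)" for n
  define Z where "Z = (\<Sum>n. z n)"
  have "summable (\<lambda>n. real n powr - (1 + c))"
    using assms by (simp add: summable_real_powr_iff)
  then have "summable z"
    unfolding z_def by (subst summable_Suc_iff)
  then have Z: "sum z {..<n} \<le> Z" "Z \<ge> 0" for n
    unfolding Z_def by (intro sum_le_suminf suminf_nonneg; simp add: z_def)+
  \<comment> \<open>The 12 serves the logarithmic term; \<open>16 * Z\<close> absorbs the loss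
    \<open>1/16\<close> in the Gram bound and the total of the increments. Both depend on
    \<open>c\<close> alone.\<close>
  define D where "D = 12 + 16 * Z"
  have D: "D \<ge> 12" "16 * Z \<le> D"
    using Z(2) by (auto simp: D_def)
  show ?thesis
  proof (rule exI[of _ D], intro allI impI)
    fix d :: nat and sg sbar :: real and mubar mu0 :: "real Matrix.vec"
    assume "d \<ge> 1" and dims: "dim_vec mubar = d" "dim_vec mu0 = d" and "sg > 0" "sbar > 0"
    obtain F :: real where "F \<ge> 0" and F:
      "\<And>m t. \<exists>B\<in>ds.events. ds.prob B \<le> F * exp (- real m / 4) \<and>
        (\<forall>\<omega> w. \<omega> \<notin> B \<longrightarrow> real m / 16 * (\<Sum>j<d. (w j)\<^sup>2) \<le> design_form d m \<omega> t w)"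
      using design_form_lower_event[OF \<open>d \<ge> 1\<close>] by metis
    \<comment> \<open>Round \<open>t = n + 1\<close> has the denominator
      \<open>t + 1 = n + 2\<close>.\<close>
    define q :: "nat \<Rightarrow> real" where "q n = inverse (real (Suc (Suc n)) ^ 2)" for n
    have "summable (\<lambda>n. inverse (real n ^ 2))"
      by (rule inverse_power_summable) simp
    then have q: "summable q"
      by (simp only: q_def[abs_def] summable_Suc_iff[of "\<lambda>n. inverse (real (Suc n) ^ 2)"]
          summable_Suc_iff[of "\<lambda>n. inverse (real n ^ 2)"])
    define S where "S = suminf q"
    have "S \<ge> 0"
      unfolding S_def using q by (rule suminf_nonneg) (simp add: q_def)
    \<comment> \<open>Below this threshold both \<open>eps\<close> and \<open>eps * F * S\<close>
      are less than 1. It depends on \<open>d\<close> through \<open>F\<close>, while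
      \<open>D\<close> does not.\<close>
    define eps0 where "eps0 = 1 / (F * S + 1)"
    have FS: "F * S + 1 \<ge> 1"
      using \<open>F \<ge> 0\<close> \<open>S \<ge> 0\<close> by simp
    let ?r = "norm2 (mu0 - mubar)"
    have "let m = sample_size c D d ?r sg sbar delta eps in
        ds.prob {\<omega> \<in> space design_space. \<forall>t\<ge>1. norm2 (Emu d sg sbar mubar mu0 m \<omega> t - mu0) \<le> delta}
          > 1 - eps"
      if "0 < delta" "0 < eps" "eps < eps0" for delta eps
    proof -
      define m where "m = sample_size c D d ?r sg sbar delta eps"
      have "eps * (F * S + 1) < 1"
        using that FS by (simp add: eps0_def field_simps)
      moreover have "0 \<le> eps * (F * S)"
        using that \<open>F \<ge> 0\<close> \<open>S \<ge> 0\<close> by simp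
      ultimately have eps: "eps < 1" "eps * (F * S) < 1"
        using that by (simp_all add: distrib_left)
      note size = sample_size_lower[where r = ?r, OF D(1) \<open>d \<ge> 1\<close> norm2_nonneg \<open>0 < delta\<close>
          \<open>0 < eps\<close> eps(1)]
      have "\<forall>t. \<exists>B. B \<in> ds.events \<and> ds.prob B \<le> F * exp (- real (m t) / 4) \<and>
        (\<forall>\<omega> w. \<omega> \<notin> B \<longrightarrow> real (m t) / 16 * (\<Sum>j<d. (w j)\<^sup>2) \<le> design_form d (m t) \<omega> t w)"
        using F by (simp add: Bex_def)
      then obtain B where B: "\<And>t. B t \<in> ds.events"
        "\<And>t. ds.prob (B t) \<le> F * exp (- real (m t) / 4)"
        "\<And>t \<omega> w. \<omega> \<notin> B t \<Longrightarrow> real (m t) / 16 * (\<Sum>j<d. (w j)\<^sup>2) \<le> design_form d (m t) \<omega> t w"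
        by metis
      \<comment> \<open>The bad event collects the rounds from 1 on, since the recursion uses no
        design in round 0.\<close>
      define A where "A = (\<Union>n. B (Suc n))"
      have A: "A \<in> ds.events"
        unfolding A_def using B(1) by (intro sets.countable_UN) auto
      have prob_B: "ds.prob (B (Suc n)) \<le> F * eps\<^sup>2 * q n" for n
      proof -
        have "exp (- real (m (Suc n)) / 4) \<le> (eps / (real (Suc n) + 1)) ^ 3"
          unfolding m_def by (rule size(2))
        also have "\<dots> = (eps / (real (Suc n) + 1))\<^sup>2 * (eps / (real (Suc n) + 1))"
          by (simp add: power2_eq_square power3_eq_cube)
        \<comment> \<open>One factor of the cube is given up. The square keeps summability in
          \<open>n\<close>, and its \<open>eps^2\<close> leaves a spare \<open>eps\<close> to beat
          \<open>F * S\<close>.\<close>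
        also have "\<dots> \<le> (eps / (real (Suc n) + 1))\<^sup>2 * 1"
          using eps(1) that by (intro mult_left_mono) (auto simp: field_simps)
        also have "\<dots> = eps\<^sup>2 * q n"
          by (simp add: q_def power_mult_distrib power_inverse divide_inverse add.commute)
        finally have "F * exp (- real (m (Suc n)) / 4) \<le> F * (eps\<^sup>2 * q n)"
          using \<open>F \<ge> 0\<close> by (rule mult_left_mono)
        then show ?thesis
          using B(2)[of "Suc n"] by (simp add: mult.assoc)
      qed
      have sum_q: "summable (\<lambda>n. F * eps\<^sup>2 * q n)"
        using q by (rule summable_mult)
      then have sum_B: "summable (\<lambda>n. ds.prob (B (Suc n)))"
        by (rule summable_comparison_test'[where N = 0]) (simp add: prob_B)
      have "ds.prob A \<le> (\<Sum>n. ds.prob (B (Suc n)))"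
        unfolding A_def using B(1) sum_B
        by (intro ds.finite_measure_subadditive_countably) auto
      also have "\<dots> \<le> (\<Sum>n. F * eps\<^sup>2 * q n)"
        using prob_B sum_B sum_q by (rule suminf_le)
      also have "\<dots> = eps * (eps * (F * S))"
        using q by (simp add: suminf_mult S_def power2_eq_square)
      also have "\<dots> < eps * 1"
        using eps(2) that by (intro mult_strict_left_mono) auto
      finally have prob_A: "ds.prob A < eps"
        by simp
      \<comment> \<open>Chosen so that the polynomial part of the sample size alone gives exactly
        \<open>r\<close> in the condition on \<open>g\<close>; the sum of all \<open>g n\<close> is
        at most \<open>delta * 16 * Z / D\<close>, hence at most \<open>delta\<close>.\<close>
      define g where "g n = delta * (16 / D) * z n" for n
      have "norm2 (Emu d sg sbar mubar mu0 m \<omega> t - mu0) \<le> delta" if "\<omega> \<notin> A" for \<omega> t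
      proof -
        have "norm2 (Emu d sg sbar mubar mu0 m \<omega> t - mu0) \<le> (\<Sum>s<t. g s)"
        proof (rule Emu_deviation_bound[OF dims, where b = "\<lambda>n. real (m (Suc n)) / 16"])
          show "real (m (Suc n)) / 16 * (\<Sum>j<d. (w j)\<^sup>2) \<le> design_form d (m (Suc n)) \<omega> (Suc n) w"
            for n w
            using that by (intro B(3)) (auto simp: A_def)
          show "g n > 0" for n
            using D(1) \<open>0 < delta\<close> by (simp add: g_def z_def)
          show "?r \<le> (sbar / sg)\<^sup>2 * (real (m (Suc n)) / 16) * g n" for n
          proof -
            define p where "p = real (Suc n) powr (1 + c)"
            have p: "p > 0" "z n = 1 / p"
              by (simp add: p_def) (simp only: p_def z_def powr_minus_divide)
            have "D * (?r / delta) * (sg / sbar)\<^sup>2 * p \<le> real (m (Suc n))"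
              unfolding p_def m_def by (rule size(1))
            then have "(sbar / sg)\<^sup>2 * ((D * (?r / delta) * (sg / sbar)\<^sup>2 * p) / 16) * g n
                \<le> (sbar / sg)\<^sup>2 * (real (m (Suc n)) / 16) * g n"
              using D(1) \<open>0 < delta\<close> p
              by (intro mult_right_mono mult_left_mono divide_right_mono) (auto simp: g_def)
            moreover have "(sbar / sg)\<^sup>2 * ((D * (?r / delta) * (sg / sbar)\<^sup>2 * p) / 16) * g n = ?r"
              using D(1) \<open>0 < delta\<close> p \<open>sg > 0\<close> \<open>sbar > 0\<close>
              by (simp add: g_def field_simps power2_eq_square)
            ultimately show ?thesis
              by linarith
          qed
        qed simp
        also have "\<dots> = delta * (16 / D) * (\<Sum>s<t. z s)"
          by (simp add: g_def sum_distrib_left)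
        also have "\<dots> \<le> delta * (16 / D) * Z"
          using D(1) \<open>0 < delta\<close> by (intro mult_left_mono Z(1)) auto
        also have "\<dots> \<le> delta"
          using D \<open>0 < delta\<close> by (simp add: field_simps)
        finally show ?thesis .
      qed
      then have "space design_space - A
          \<subseteq> {\<omega> \<in> space design_space. \<forall>t\<ge>1. norm2 (Emu d sg sbar mubar mu0 m \<omega> t - mu0) \<le> delta}"
        by blast
      then have "ds.prob (space design_space - A)
          \<le> ds.prob {\<omega> \<in> space design_space. \<forall>t\<ge>1. norm2 (Emu d sg sbar mubar mu0 m \<omega> t - mu0) \<le> delta}"
        by (rule ds.finite_measure_mono) (rule Emu_deviation_event[OF dims])
      then show ?thesis
        using prob_A ds.prob_compl[OF A] unfolding Let_def m_def[symmetric] by linarith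
    qed
    moreover have "eps0 > 0"
      using FS by (simp add: eps0_def)
    ultimately show "\<exists>delta0>0. \<exists>eps0>0. \<forall>delta eps. 0 < delta \<longrightarrow> delta < delta0 \<longrightarrow> 0 < eps \<longrightarrow> eps < eps0 \<longrightarrow>
      (let m = sample_size c D d ?r sg sbar delta eps in
        ds.prob {\<omega> \<in> space design_space. \<forall>t\<ge>1. norm2 (Emu d sg sbar mubar mu0 m \<omega> t - mu0) \<le> delta}
          > 1 - eps)"
      \<comment> \<open>The claim just shown covers every positive \<open>delta\<close>, so any
        positive number can be the witness for \<open>delta0\<close>.\<close>
      by (intro exI[of _ "1 :: real"] exI[of _ eps0] conjI allI impI) auto
  qed
qed

end
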